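(* Let $A=(A_1,A_2)$ be a commuting pure $2$-contraction on a complex Hilbert space $\mathcal{H}$ such that $D_{A^*}$ is one to one, and let $(z_1,z_2)\in\mathbb{D}^2$. Then $(z_1,z_2)\in\sigma_T^{(2)}(A_1,A_2)$ if and only if the equation $\theta_A(z_1,z_2)Y=0$ admits at least one nontrivial (i.e. nonzero) solution of the form $Y=D_A(X)$, $X\in\mathcal{H}^2$, such that $$X\neq\begin{pmatrix}(A_1-z_1)h\\(z_2-A_2)h\end{pmatrix}\quad\text{for all }h\in\mathcal{H}.$$
   Context: $\mathbb{D}^2=\{(z_1,z_2)\in\mathbb{C}^2: |z_1|^2+|z_2|^2<1\}$. A pair $A=(A_1,A_2)$ of bounded operators on $\mathcal{H}$ is a commuting $2$-contraction if $A_1A_2=A_2A_1$ and $\|A_1h_1+A_2h_2\|^2\le\|h_1\|^2+\|h_2\|^2$ for all $h_1,h_2\in\mathcal{H}$ (equivalently $A_1A_1^*+A_2A_2^*\le 1_{\mathcal{H}}$). $A$ is also regarded as the operator $A:\mathcal{H}^2\to\mathcal{H}$, $A(h_1,h_2)=A_1h_1+A_2h_2$, with adjoint $A^*h=(A_1^*h,A_2^*h)$. $A$ is pure if $P_A^n(1_{\mathcal{H}})\to 0$ strongly as $n\to\infty$, where $P_A(T)=A_1TA_1^*+A_2TA_2^*$. $D_{A^*}=(1_{\mathcal{H}}-AA^* )^{1/2}=(1_{\mathcal{H}}-A_1A_1^*-A_2A_2^* )^{1/2}$ on $\mathcal{H}$ and $D_A=(1_{\mathcal{H}^2}-A^*A)^{1/2}$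 on $\mathcal{H}^2$; $\mathcal{D}_{A^*}$ and $\mathcal{D}_A$ are the closures of the ranges of $D_{A^*}$ and $D_A$. The characteristic function of $A$ is $\theta_A:\mathbb{D}^2\to B(\mathcal{D}_A,\mathcal{D}_{A^*})$, $$\theta_A(z_1,z_2)=-A+D_{A^*}(1_{\mathcal{H}}-z_1A_1^*-z_2A_2^* )^{-1}(z_1 1_{\mathcal{H}},z_2 1_{\mathcal{H}})D_A$$ (restricted to $\mathcal{D}_A$), where $(z_1 1_{\mathcal{H}},z_2 1_{\mathcal{H}}):\mathcal{H}^2\to\mathcal{H}$ maps $(h_1,h_2)$ to $z_1h_1+z_2h_2$. $\sigma_T^{(2)}(A_1,A_2)$ denotes the set of $(z_1,z_2)\in\mathbb{C}^2$ for which there is $(x_1,x_2)\in\mathcal{H}^2$ with $(A_1-z_1)x_1-(A_2-z_2)x_2=0$ and $(x_1,x_2)\neq((A_1-z_1)h,(A_2-z_2)h)$ for all $h\in\mathcal{H}$. *)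

theory Defs
  imports "HOL-Analysis.Analysis"
begin

text \<open>The class below equips a real inner product space with complex scalars and a complex
  inner product, linear in the first argument, of which the given real inner product is the real
  part. Norm and topology are then those induced by the complex inner product.\<close>

class complex_inner = real_inner +
  fixes scaleC :: "complex \<Rightarrow> 'a \<Rightarrow> 'a" (infixr "*\<^sub>C" 75)
    and cinner :: "'a \<Rightarrow> 'a \<Rightarrow> complex"
  assumes scaleC_add_right: "c *\<^sub>C (x + y) = c *\<^sub>C x + c *\<^sub>C y"
    and scaleC_add_left: "(c + d) *\<^sub>C x = c *\<^sub>C x + d *\<^sub>C x"
    and scaleC_scaleC: "c *\<^sub>C d *\<^sub>C x = (c * d) *\<^sub>C x"
    and scaleC_of_real: "complex_of_real r *\<^sub>C x = r *\<^sub>R x"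
    and cinner_add_left: "cinner (x + y) w = cinner x w + cinner y w"
    and cinner_scaleC_left: "cinner (c *\<^sub>C x) y = c * cinner x y"
    and cinner_commute: "cinner x y = cnj (cinner y x)"
    and inner_eq_Re_cinner: "inner x y = Re (cinner x y)"

class complex_hilbert = complex_inner + complete_space

text \<open>The Hilbert space direct sum. The norm on pairs from the library is the
  square root of the sum of the squares of the norms of the components.\<close>

instantiation prod :: (complex_inner, complex_inner) complex_inner
begin

definition scaleC_prod :: "complex \<Rightarrow> 'a \<times> 'b \<Rightarrow> 'a \<times> 'b" where
  "scaleC_prod c x = (c *\<^sub>C fst x, c *\<^sub>C snd x)"

definition cinner_prod :: "'a \<times> 'b \<Rightarrow> 'a \<times> 'b \<Rightarrow> complex" where
  "cinner_prod x y = cinner (fst x) (fst y) + cinner (snd x) (snd y)"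

instance
proof
  fix c d :: complex and r :: real and x y w :: "'a \<times> 'b"
  show "c *\<^sub>C (x + y) = c *\<^sub>C x + c *\<^sub>C y"
    by (simp add: scaleC_prod_def scaleC_add_right)
  show "(c + d) *\<^sub>C x = c *\<^sub>C x + d *\<^sub>C x"
    by (simp add: scaleC_prod_def scaleC_add_left)
  show "c *\<^sub>C d *\<^sub>C x = (c * d) *\<^sub>C x"
    by (simp add: scaleC_prod_def scaleC_scaleC)
  show "complex_of_real r *\<^sub>C x = r *\<^sub>R x"
    by (simp add: scaleC_prod_def scaleC_of_real prod_eq_iff)
  show "cinner (x + y) w = cinner x w + cinner y w"
    by (simp add: cinner_prod_def cinner_add_left)
  show "cinner (c *\<^sub>C x) y = c * cinner x y"
    by (simp add: cinner_prod_def scaleC_prod_def cinner_scaleC_left distrib_left)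
  show "cinner x y = cnj (cinner y x)"
    by (simp add: cinner_prod_def cinner_commute[of "fst x"] cinner_commute[of "snd x"])
  show "inner x y = Re (cinner x y)"
    by (simp add: cinner_prod_def inner_prod_def inner_eq_Re_cinner)
qed

end

instance prod :: (complex_hilbert, complex_hilbert) complex_hilbert ..

definition bounded_clinear :: "('a::complex_inner \<Rightarrow> 'b::complex_inner) \<Rightarrow> bool" where
  "bounded_clinear T \<longleftrightarrow> bounded_linear T \<and> (\<forall>c x. T (c *\<^sub>C x) = c *\<^sub>C T x)"

definition cadjoint :: "('a::complex_inner \<Rightarrow> 'b::complex_inner) \<Rightarrow> 'b \<Rightarrow> 'a" where
  "cadjoint T = (THE S. \<forall>x y. cinner (T x) y = cinner x (S y))"

definition positive_op :: "('a::complex_inner \<Rightarrow> 'a) \<Rightarrow> bool" where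
  "positive_op T \<longleftrightarrow> bounded_clinear T \<and> (\<forall>x. cinner (T x) x \<in> \<real>\<^sub>\<ge>\<^sub>0)"

definition sqrt_op :: "('a::complex_inner \<Rightarrow> 'a) \<Rightarrow> 'a \<Rightarrow> 'a" where
  "sqrt_op T = (THE S. positive_op S \<and> S \<circ> S = T)"

definition row_op ::
  "('a::complex_inner \<Rightarrow> 'a) \<Rightarrow> ('a \<Rightarrow> 'a) \<Rightarrow> 'a \<times> 'a \<Rightarrow> 'a" where
  "row_op A1 A2 = (\<lambda>(h1, h2). A1 h1 + A2 h2)"

definition commuting_2_contraction ::
  "('a::complex_inner \<Rightarrow> 'a) \<Rightarrow> ('a \<Rightarrow> 'a) \<Rightarrow> bool" where
  "commuting_2_contraction A1 A2 \<longleftrightarrow>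
     bounded_clinear A1 \<and> bounded_clinear A2 \<and> A1 \<circ> A2 = A2 \<circ> A1 \<and>
     (\<forall>h1 h2. (norm (A1 h1 + A2 h2))\<^sup>2 \<le> (norm h1)\<^sup>2 + (norm h2)\<^sup>2)"

definition cp_map ::
  "('a::complex_inner \<Rightarrow> 'a) \<Rightarrow> ('a \<Rightarrow> 'a) \<Rightarrow> ('a \<Rightarrow> 'a) \<Rightarrow> 'a \<Rightarrow> 'a" where
  "cp_map A1 A2 T = (\<lambda>h. A1 (T (cadjoint A1 h)) + A2 (T (cadjoint A2 h)))"

definition pure_pair :: "('a::complex_inner \<Rightarrow> 'a) \<Rightarrow> ('a \<Rightarrow> 'a) \<Rightarrow> bool" where
  "pure_pair A1 A2 \<longleftrightarrow> (\<forall>h. (\<lambda>n. (cp_map A1 A2 ^^ n) id h) \<longlonglongrightarrow> 0)"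

definition defect_op ::
  "('a::complex_inner \<Rightarrow> 'a) \<Rightarrow> ('a \<Rightarrow> 'a) \<Rightarrow> 'a \<times> 'a \<Rightarrow> 'a \<times> 'a" where
  "defect_op A1 A2 = sqrt_op (\<lambda>x. x - cadjoint (row_op A1 A2) (row_op A1 A2 x))"

definition defect_op_star ::
  "('a::complex_inner \<Rightarrow> 'a) \<Rightarrow> ('a \<Rightarrow> 'a) \<Rightarrow> 'a \<Rightarrow> 'a" where
  "defect_op_star A1 A2 = sqrt_op (\<lambda>h. h - row_op A1 A2 (cadjoint (row_op A1 A2) h))"

definition defect_space ::
  "('a::complex_inner \<Rightarrow> 'a) \<Rightarrow> ('a \<Rightarrow> 'a) \<Rightarrow> ('a \<times> 'a) set" where
  "defect_space A1 A2 = closure (range (defect_op A1 A2))"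

definition unit_ball2 :: "(complex \<times> complex) set" where
  "unit_ball2 = {(z1, z2). (cmod z1)\<^sup>2 + (cmod z2)\<^sup>2 < 1}"

text \<open>The characteristic function at a point of the unit ball, as a map with domain
  the defect space (and unspecified outside of it).\<close>

definition char_fun ::
  "('a::complex_inner \<Rightarrow> 'a) \<Rightarrow> ('a \<Rightarrow> 'a) \<Rightarrow> complex \<times> complex \<Rightarrow> 'a \<times> 'a \<Rightarrow> 'a" where
  "char_fun A1 A2 = (\<lambda>(z1, z2). \<lambda>Y\<in>defect_space A1 A2.
     - row_op A1 A2 Y +
     defect_op_star A1 A2
       (inv (\<lambda>h. h - z1 *\<^sub>C cadjoint A1 h - z2 *\<^sub>C cadjoint A2 h)
         (row_op (\<lambda>h. z1 *\<^sub>C h) (\<lambda>h. z2 *\<^sub>C h) (defect_op A1 A2 Y))))"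

definition taylor_spectrum2 ::
  "('a::complex_inner \<Rightarrow> 'a) \<Rightarrow> ('a \<Rightarrow> 'a) \<Rightarrow> (complex \<times> complex) set" where
  "taylor_spectrum2 A1 A2 = {(z1, z2). \<exists>x1 x2.
     (A1 x1 - z1 *\<^sub>C x1) - (A2 x2 - z2 *\<^sub>C x2) = 0 \<and>
     (\<forall>h. (x1, x2) \<noteq> (A1 h - z1 *\<^sub>C h, A2 h - z2 *\<^sub>C h))}"

end

theory Submission
  imports Defs
begin

text \<open>
  Write \<open>A\<close> for the row operator of the pair, \<open>z\<close> for the row \<open>(h\<^sub>1, h\<^sub>2) \<mapsto> z\<^sub>1 h\<^sub>1 + z\<^sub>2 h\<^sub>2\<close>,
  \<open>D\<close> for the defect operator of \<open>A\<close> and \<open>E\<close> for that of \<open>A*\<close>. Since \<open>A D = E A\<close> and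
  \<open>D D = 1 - A* A\<close>, the characteristic function factorises on the range of \<open>D\<close>:
  \<open>\<theta>(z) (D X) = E (1 - z A*)\<inverse> (z - A) X\<close>. As \<open>E\<close> is one to one, \<open>D X\<close> is therefore a zero of
  \<open>\<theta>(z)\<close> exactly if \<open>A X = z X\<close> (lemma \<open>char_fun_defect_eq_0_iff\<close>). Changing the sign of
  the second component turns \<open>A X = z X\<close> into the equation in the definition of the spectrum, and
  turns the excluded vectors there into those excluded for \<open>X\<close>. What remains is that \<open>D X\<close> is
  automatically nonzero: \<open>D X = 0\<close> and \<open>A X = z X\<close> give \<open>X = A* A X = A* z X\<close>, whose norm is
  at most \<open>\<bar>z\<bar> \<parallel>X\<parallel>\<close>, so \<open>X = 0\<close> (lemma \<open>defect_eigenvector_eq_0\<close>); and zero is an excluded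
  vector.

  Adjoints, square roots and inverses enter through description operators, so each has to be
  shown to exist and to be unique. Adjoints come from the Riesz representation theorem.
  The square root of \<open>1 - B\<close> for a self-adjoint contraction \<open>B\<close> is \<open>1 - C\<close>, where
  \<open>C\<close> is the limit of the iteration \<open>C \<mapsto> (B + C\<^sup>2) / 2\<close> started at zero. Every bounded
  operator intertwining \<open>B\<close> with \<open>B'\<close> intertwines all the iterates and hence their limits;
  this yields both the uniqueness of the root and the relation \<open>A D = E A\<close>. Finally,
  \<open>1 - z A*\<close> is bijective by the contraction principle.
\<close>

section \<open>Real and complex inner products\<close>

lemma quadratic_nonneg_imp_linear_coeff_zero:
  fixes a b :: real
  assumes "\<And>t. 0 \<le> t * a + t\<^sup>2 * b"
  shows "a = 0"
proof (rule ccontr)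
  assume a: "a \<noteq> 0"
  define d where "d = \<bar>b\<bar> + 1"
  have d: "d > 0" "b < d" unfolding d_def by auto
  have "0 \<le> (- a / d) * a + (- a / d)\<^sup>2 * b" by (rule assms)
  also have "\<dots> = a\<^sup>2 * (b - d) / d\<^sup>2"
    using d by (simp add: field_simps power2_eq_square)
  also have "\<dots> < 0"
    using a d by (intro divide_neg_pos mult_pos_neg) auto
  finally show False by simp
qed

text \<open>The real inner product determines the complex one: its real part is given, and its imaginary
  part is a real inner product with a rotated vector (lemma \<open>Im_cinner_eq_inner\<close>). This allows
  everything below to be argued with the real inner product.\<close>

lemma inner_scaleC_left:
  fixes x y :: "'a::complex_inner"
  shows "inner (c *\<^sub>C x) y = inner x (cnj c *\<^sub>C y)"
proof -
  have "cinner x (cnj c *\<^sub>C y) = c * cinner x y"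
    by (metis cinner_commute cinner_scaleC_left complex_cnj_cnj complex_cnj_mult)
  thus ?thesis by (simp add: inner_eq_Re_cinner cinner_scaleC_left)
qed

lemma Im_cinner_eq_inner:
  fixes x y :: "'a::complex_inner"
  shows "Im (cinner x y) = inner x (\<i> *\<^sub>C y)"
  using inner_scaleC_left[of "-\<i>" x y]
  by (simp add: inner_eq_Re_cinner cinner_scaleC_left)

lemma cinner_eqI:
  fixes x y :: "'a::complex_inner" and u v :: "'b::complex_inner"
  assumes "inner x y = inner u v" "inner x (\<i> *\<^sub>C y) = inner u (\<i> *\<^sub>C v)"
  shows "cinner x y = cinner u v"
  using assms by (simp add: complex_eq_iff Im_cinner_eq_inner flip: inner_eq_Re_cinner)

lemma norm_scaleC:
  fixes x :: "'a::complex_inner"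
  shows "norm (c *\<^sub>C x) = cmod c * norm x"
proof -
  have "(norm (c *\<^sub>C x))\<^sup>2 = inner x (cnj c *\<^sub>C c *\<^sub>C x)"
    by (simp add: power2_norm_eq_inner inner_scaleC_left)
  also have "cnj c *\<^sub>C c *\<^sub>C x = (cmod c)\<^sup>2 *\<^sub>R x"
    by (metis scaleC_scaleC scaleC_of_real complex_norm_square mult.commute)
  also have "inner x \<dots> = (cmod c * norm x)\<^sup>2"
    by (simp add: power_mult_distrib power2_norm_eq_inner)
  finally show ?thesis by (simp add: power2_eq_iff_nonneg)
qed

lemma bounded_clinear_scaleC: "bounded_clinear (\<lambda>x::'a::complex_inner. c *\<^sub>C x)"
proof -
  have "c *\<^sub>C r *\<^sub>R x = r *\<^sub>R c *\<^sub>C x" for r and x :: 'a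
    by (metis scaleC_of_real scaleC_scaleC mult.commute)
  moreover have "c *\<^sub>C d *\<^sub>C x = d *\<^sub>C c *\<^sub>C x" for d and x :: 'a
    by (metis scaleC_scaleC mult.commute)
  ultimately show ?thesis unfolding bounded_clinear_def
    by (auto intro!: bounded_linear_intro[where K = "cmod c"]
        simp: scaleC_add_right norm_scaleC)
qed

lemma linear_scaleC: "linear (\<lambda>x::'a::complex_inner. c *\<^sub>C x)"
  using bounded_clinear_scaleC unfolding bounded_clinear_def by (blast intro: bounded_linear.linear)

lemma scaleC_minus_left: "(- c) *\<^sub>C x = - (c *\<^sub>C (x::'a::complex_inner))"
  using scaleC_scaleC[of "-1" c x] scaleC_of_real[of "-1" "c *\<^sub>C x"] by simp

lemma scaleC_diff_right: "c *\<^sub>C (x - y) = c *\<^sub>C x - c *\<^sub>C (y::'a::complex_inner)"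
  by (rule linear_diff[OF linear_scaleC])

section \<open>Adjoints\<close>

text \<open>The representing vector is the minimiser of \<open>\<parallel>x\<parallel>\<^sup>2 / 2 - f x\<close>. The functional is bounded
  below because \<open>f\<close> is bounded, the parallelogram law makes minimising sequences Cauchy, and
  the first variation at the minimiser is \<open>v \<mapsto> \<langle>l, v\<rangle> - f v\<close>.\<close>

lemma riesz_representation:
  fixes f :: "'a::{real_inner,complete_space} \<Rightarrow> real"
  assumes f: "bounded_linear f"
  shows "\<exists>y. \<forall>x. f x = inner x y"
proof -
  interpret f: bounded_linear f by (rule f)
  obtain K where K: "\<And>x. norm (f x) \<le> norm x * K" using f.bounded by auto
  define g where "g x = (norm x)\<^sup>2 / 2 - f x" for x
  have g_lower: "g x \<ge> - K\<^sup>2 / 2" for x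
  proof -
    have "f x \<le> norm x * K" using K[of x] by simp
    moreover have "0 \<le> (norm x - K)\<^sup>2" by simp
    ultimately show ?thesis by (simp add: g_def power2_diff)
  qed
  define m where "m = Inf (range g)"
  have bdd: "bdd_below (range g)" by (intro bdd_belowI2[where m = "- K\<^sup>2 / 2"] g_lower)
  have m_le: "m \<le> g x" for x unfolding m_def using bdd by (simp add: cInf_lower)
  have "\<exists>x. g x < m + 1 / real (Suc n)" for n
    using cInf_lessD[of "range g" "m + 1 / real (Suc n)"] by (auto simp: m_def)
  then obtain x where x: "\<And>n. g (x n) < m + 1 / real (Suc n)" by metis
  \<comment> \<open>The parallelogram law; the linear part of \<open>g\<close> cancels.\<close>
  have mid: "g u + g v - 2 * g ((1/2) *\<^sub>R (u + v)) = (norm (u - v))\<^sup>2 / 4" for u v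
    by (simp add: g_def f.add f.scaleR power2_norm_eq_inner inner_simps inner_commute[of v u]
        field_simps)
  have close: "(norm (x j - x k))\<^sup>2 \<le> 4 * (1 / real (Suc j) + 1 / real (Suc k))" for j k
    using mid[of "x j" "x k"] x[of j] x[of k] m_le[of "(1/2) *\<^sub>R (x j + x k)"] by argo
  have "Cauchy x"
  proof (rule metric_CauchyI)
    fix e :: real assume e: "e > 0"
    obtain N where N: "1 / real (Suc N) < e\<^sup>2 / 8"
      using nat_approx_posE[of "e\<^sup>2 / 8"] e by (metis divide_pos_pos zero_less_numeral zero_less_power)
    have "dist (x j) (x k) < e" if "j \<ge> N" "k \<ge> N" for j k
    proof -
      have "1 / real (Suc j) \<le> 1 / real (Suc N)" "1 / real (Suc k) \<le> 1 / real (Suc N)"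
        using that by (auto intro!: divide_left_mono)
      hence "(norm (x j - x k))\<^sup>2 < e\<^sup>2" using close[of j k] N by argo
      thus ?thesis using e by (simp add: dist_norm power_less_imp_less_base)
    qed
    thus "\<exists>M. \<forall>j\<ge>M. \<forall>k\<ge>M. dist (x j) (x k) < e" by blast
  qed
  then obtain l where l: "x \<longlonglongrightarrow> l" using Cauchy_convergent convergent_def by blast
  have "(\<lambda>n. g (x n)) \<longlonglongrightarrow> g l" unfolding g_def
    by (intro tendsto_intros f.tendsto l) auto
  moreover have "(\<lambda>n. m + 1 / real (Suc n)) \<longlonglongrightarrow> m + 0"
    using LIMSEQ_inverse_real_of_nat by (intro tendsto_intros) (simp add: inverse_eq_divide)
  ultimately have "g l \<le> m + 0" using x by (intro LIMSEQ_le) (auto intro: less_imp_le)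
  hence min: "g l \<le> g w" for w using m_le[of w] by simp
  have "inner l v - f v = 0" for v
  proof (rule quadratic_nonneg_imp_linear_coeff_zero)
    fix t :: real
    have "0 \<le> g (l + t *\<^sub>R v) - g l" using min by simp
    also have "\<dots> = t * (inner l v - f v) + t\<^sup>2 * (inner v v / 2)"
      by (simp add: g_def f.add f.scaleR power2_norm_eq_inner inner_simps inner_commute[of v l]
          power2_eq_square[of t] field_simps)
    finally show "0 \<le> t * (inner l v - f v) + t\<^sup>2 * (inner v v / 2)" .
  qed
  thus ?thesis by (metis inner_commute eq_iff_diff_eq_0)
qed

lemma ex_real_adjoint:
  fixes T :: "'a::complex_hilbert \<Rightarrow> 'b::complex_hilbert"
  assumes "bounded_clinear T"
  shows "\<exists>S. \<forall>x y. inner (T x) y = inner x (S y)"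
proof -
  have T: "bounded_linear T" using assms by (simp add: bounded_clinear_def)
  have "\<exists>s. \<forall>x. inner (T x) y = inner x s" for y
    by (rule riesz_representation)
      (rule bounded_linear_compose[OF bounded_linear_inner_left T])
  thus ?thesis by metis
qed

text \<open>The adjoint for the real inner product exists by the Riesz theorem. Moving complex scalars
  across the inner product shows that it is complex linear, and so it is the complex
  adjoint as well.\<close>

lemma inner_cadjoint:
  fixes T :: "'a::complex_hilbert \<Rightarrow> 'b::complex_hilbert"
  assumes T: "bounded_clinear T"
  shows "inner (T x) y = inner x (cadjoint T y)"
proof -
  obtain S where S: "\<And>x y. inner (T x) y = inner x (S y)" using ex_real_adjoint[OF T] by blast
  have SC: "S (c *\<^sub>C y) = c *\<^sub>C S y" for c y
  proof (rule vector_eq_ldot[THEN iffD1], rule allI)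
    fix x
    have "inner x (S (c *\<^sub>C y)) = inner (c *\<^sub>C y) (T x)" by (simp flip: S add: inner_commute)
    also have "\<dots> = inner y (T (cnj c *\<^sub>C x))"
      using T by (simp add: inner_scaleC_left bounded_clinear_def)
    also have "\<dots> = inner x (c *\<^sub>C S y)"
      by (subst inner_commute) (simp add: S inner_scaleC_left)
    finally show "inner x (S (c *\<^sub>C y)) = inner x (c *\<^sub>C S y)" .
  qed
  have "cadjoint T = S" unfolding cadjoint_def
  proof (rule the_equality)
    show "\<forall>x y. cinner (T x) y = cinner x (S y)"
      by (auto intro!: cinner_eqI simp: S simp flip: SC)
    fix S' assume "\<forall>x y. cinner (T x) y = cinner x (S' y)"
    hence "inner x (S' y) = inner x (S y)" for x y
      by (metis S inner_eq_Re_cinner)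
    thus "S' = S" by (metis ext vector_eq_ldot)
  qed
  thus ?thesis by (simp add: S)
qed

lemma cadjoint_eqI:
  fixes T :: "'a::complex_hilbert \<Rightarrow> 'b::complex_hilbert"
  assumes "bounded_clinear T" "\<And>x. inner (T x) y = inner x s"
  shows "cadjoint T y = s"
  using assms by (metis inner_cadjoint vector_eq_ldot)

lemma bounded_clinear_cadjoint_contraction:
  fixes T :: "'a::complex_hilbert \<Rightarrow> 'b::complex_hilbert"
  assumes T: "bounded_clinear T" and con: "\<And>x. norm (T x) \<le> norm x"
  shows "bounded_clinear (cadjoint T)" "norm (cadjoint T y) \<le> norm y"
proof -
  note adj = inner_cadjoint[OF T]
  show nrm: "norm (cadjoint T y) \<le> norm y" for y
  proof -
    have "norm (cadjoint T y) * norm (cadjoint T y) = inner (T (cadjoint T y)) y"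
      by (simp add: adj flip: power2_norm_eq_inner power2_eq_square)
    also have "\<dots> \<le> norm (T (cadjoint T y)) * norm y" by (rule norm_cauchy_schwarz)
    also have "\<dots> \<le> norm (cadjoint T y) * norm y" by (intro mult_right_mono con) auto
    finally show ?thesis by (cases "cadjoint T y = 0") auto
  qed
  have "cadjoint T (x + y) = cadjoint T x + cadjoint T y" for x y
    by (rule cadjoint_eqI[OF T]) (simp add: inner_simps adj)
  moreover have "cadjoint T (r *\<^sub>R x) = r *\<^sub>R cadjoint T x" for r x
    by (rule cadjoint_eqI[OF T]) (simp add: inner_simps adj)
  moreover have "cadjoint T (c *\<^sub>C y) = c *\<^sub>C cadjoint T y" for c y
  proof (rule cadjoint_eqI[OF T])
    fix x
    have "inner (T x) (c *\<^sub>C y) = inner (T (cnj c *\<^sub>C x)) y"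
      using T inner_scaleC_left[of "cnj c" "T x" y] by (simp add: bounded_clinear_def)
    thus "inner (T x) (c *\<^sub>C y) = inner x (c *\<^sub>C cadjoint T y)"
      by (simp add: adj inner_scaleC_left)
  qed
  ultimately show "bounded_clinear (cadjoint T)" unfolding bounded_clinear_def
    using nrm by (auto intro!: bounded_linear_intro[where K = 1])
qed

section \<open>Positive square roots\<close>

text \<open>Over the complex numbers a nonnegative quadratic form already forces self-adjointness.
  With the real inner product, \<open>Im \<langle>T x, x\<rangle> = 0\<close> says that \<open>T x\<close> is orthogonal to \<open>\<i> x\<close>;
  polarising this at \<open>x\<close> and \<open>- \<i> y\<close> gives the symmetry.\<close>

lemma positive_op_iff:
  fixes T :: "'a::complex_inner \<Rightarrow> 'a"
  shows "positive_op T \<longleftrightarrow> bounded_clinear T \<and> (\<forall>x. 0 \<le> inner (T x) x) \<and>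
    (\<forall>x y. inner (T x) y = inner x (T y))"
proof (intro iffI conjI allI)
  assume P: "positive_op T"
  thus T: "bounded_clinear T" and "0 \<le> inner (T x) x" for x
    by (auto simp: positive_op_def complex_nonneg_Reals_iff inner_eq_Re_cinner)
  have T': "linear T" "\<And>c x. T (c *\<^sub>C x) = c *\<^sub>C T x"
    using T by (auto simp: bounded_clinear_def bounded_linear.linear)
  have diag: "inner (T x) (\<i> *\<^sub>C x) = 0" for x
    using P by (simp add: positive_op_def complex_nonneg_Reals_iff flip: Im_cinner_eq_inner)
  fix x y :: 'a
  define v where "v = - \<i> *\<^sub>C y"
  have iv: "\<i> *\<^sub>C v = y" using scaleC_of_real[of 1 y] by (simp add: v_def scaleC_scaleC)
  have "inner (T x) (\<i> *\<^sub>C v) + inner (T v) (\<i> *\<^sub>C x) = 0"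
    using diag[of "x + v"] diag[of x] diag[of v]
    by (simp add: linear_add[OF T'(1)] scaleC_add_right inner_simps)
  moreover have "inner (T v) (\<i> *\<^sub>C x) = - inner (T y) x"
  proof -
    have "inner (T y) x = inner (T v) (cnj \<i> *\<^sub>C x)"
      by (simp add: T'(2) inner_scaleC_left flip: iv)
    also have "cnj \<i> *\<^sub>C x = - (\<i> *\<^sub>C x)"
      by (simp add: scaleC_minus_left)
    finally show ?thesis by simp
  qed
  ultimately show "inner (T x) y = inner x (T y)" using iv by (simp add: inner_commute)
next
  assume R: "bounded_clinear T \<and> (\<forall>x. 0 \<le> inner (T x) x) \<and>
    (\<forall>x y. inner (T x) y = inner x (T y))"
  have "Im (cinner (T x) x) = 0" for x
  proof -
    have "inner (T x) (\<i> *\<^sub>C x) = inner x (\<i> *\<^sub>C T x)"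
      using R by (simp add: bounded_clinear_def)
    moreover have "Im (cinner x (T x)) = - Im (cinner (T x) x)"
      by (subst cinner_commute) simp
    ultimately show ?thesis by (simp add: Im_cinner_eq_inner)
  qed
  thus "positive_op T"
    unfolding positive_op_def complex_nonneg_Reals_iff inner_eq_Re_cinner[symmetric]
    using R by blast
qed

text \<open>The form of \<open>T\<close> is nonnegative along the line \<open>y + t T y\<close> and vanishes at \<open>t = 0\<close>, so its
  derivative \<open>2 \<parallel>T y\<parallel>\<^sup>2\<close> there is zero.\<close>

lemma positive_op_kernel:
  assumes P: "positive_op T" and "inner (T y) y = 0"
  shows "T y = 0"
proof -
  have T: "linear T" "\<And>x. 0 \<le> inner (T x) x" "\<And>x y. inner (T x) y = inner x (T y)"
    using P by (auto simp: positive_op_iff bounded_clinear_def bounded_linear.linear)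
  have "2 * inner (T y) (T y) = 0"
  proof (rule quadratic_nonneg_imp_linear_coeff_zero)
    fix t :: real
    have "0 \<le> inner (T (y + t *\<^sub>R T y)) (y + t *\<^sub>R T y)" by (rule T)
    also have "\<dots> = t * (2 * inner (T y) (T y)) + t\<^sup>2 * inner (T (T y)) (T y)"
      using assms(2) T(3)[of "T y" y]
      by (simp add: linear_add[OF T(1)] linear_scale[OF T(1)] inner_simps power2_eq_square
          algebra_simps)
    finally show "0 \<le> t * (2 * inner (T y) (T y)) + t\<^sup>2 * inner (T (T y)) (T y)" .
  qed
  thus ?thesis by simp
qed

text \<open>For \<open>y = S x - T x\<close>, commutation gives \<open>S y + T y = S\<^sup>2 x - T\<^sup>2 x = 0\<close>. The two nonnegative
  numbers \<open>\<langle>S y, y\<rangle>\<close> and \<open>\<langle>T y, y\<rangle>\<close> add up to zero, so \<open>S y = T y = 0\<close>, and then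
  \<open>\<parallel>y\<parallel>\<^sup>2 = \<langle>x, S y - T y\<rangle> = 0\<close>.\<close>

lemma commuting_positive_roots_eq:
  fixes S T :: "'a::complex_inner \<Rightarrow> 'a"
  assumes S: "positive_op S" and T: "positive_op T"
    and sq: "\<And>x. S (S x) = T (T x)" and comm: "\<And>x. S (T x) = T (S x)"
  shows "S = T"
proof
  fix x
  have lin: "linear S" "linear T" and pos: "\<And>x. 0 \<le> inner (S x) x" "\<And>x. 0 \<le> inner (T x) x"
    and sym: "\<And>x y. inner (S x) y = inner x (S y)" "\<And>x y. inner (T x) y = inner x (T y)"
    using S T by (auto simp: positive_op_iff bounded_clinear_def bounded_linear.linear)
  define y where "y = S x - T x"
  have "S y + T y = 0"
    by (simp add: y_def linear_diff[OF lin(1)] linear_diff[OF lin(2)] sq comm)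
  hence "inner (S y) y + inner (T y) y = 0" by (metis inner_add_left inner_zero_left)
  hence "inner (S y) y = 0" "inner (T y) y = 0" using pos[of y] by auto
  hence "S y = 0" "T y = 0" using S T positive_op_kernel by blast+
  hence "inner y y = 0"
    using sym(1)[of x y] sym(2)[of x y] by (simp add: y_def inner_diff_left)
  thus "S x = T x" by (simp add: y_def)
qed

text \<open>If \<open>C = (B + C\<^sup>2) / 2\<close> then \<open>(1 - C)\<^sup>2 = 1 - B\<close>. The root is thus obtained by iterating the
  right-hand side.\<close>

primrec sqrt_iter :: "('a::real_vector \<Rightarrow> 'a) \<Rightarrow> nat \<Rightarrow> 'a \<Rightarrow> 'a" where
  "sqrt_iter B 0 = (\<lambda>_. 0)"
| "sqrt_iter B (Suc n) = (\<lambda>h. (1/2) *\<^sub>R (B h + sqrt_iter B n (sqrt_iter B n h)))"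

text \<open>The same iteration for the number \<open>B = 1\<close>. It increases and is bounded by 1, and it dominates
  the norms of the iterates and of their differences.\<close>

primrec sqrt_bound :: "nat \<Rightarrow> real" where
  "sqrt_bound 0 = 0"
| "sqrt_bound (Suc n) = (1 + (sqrt_bound n)\<^sup>2) / 2"

definition sqrt_limit :: "('a::complex_inner \<Rightarrow> 'a) \<Rightarrow> 'a \<Rightarrow> 'a" where
  "sqrt_limit B h = lim (\<lambda>n. sqrt_iter B n h)"

lemma sqrt_bound_range: "0 \<le> sqrt_bound n \<and> sqrt_bound n \<le> 1"
  by (induction n) (auto simp: power_le_one)

lemma sqrt_bound_mono: "sqrt_bound n \<le> sqrt_bound (Suc n)"
proof -
  have "0 \<le> (1 - sqrt_bound n)\<^sup>2" by simp
  thus ?thesis by (simp add: power2_diff)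
qed

lemma linear_sqrt_iter:
  assumes "linear B"
  shows "linear (sqrt_iter B n)"
proof (induction n)
  case 0
  show ?case by (simp add: linear_zero)
next
  case (Suc n)
  show ?case
    by (rule linearI) (simp_all add: linear_add[OF assms] linear_add[OF Suc]
        linear_scale[OF assms] linear_scale[OF Suc] algebra_simps)
qed

lemma sqrt_iter_intertwine:
  assumes "linear X" "\<And>h. X (B h) = B' (X h)"
  shows "X (sqrt_iter B n h) = sqrt_iter B' n (X h)"
  by (induction n arbitrary: h)
    (simp_all add: linear_0[OF assms(1)] linear_add[OF assms(1)] linear_scale[OF assms(1)]
      assms(2))

lemma sqrt_iter_symmetric:
  fixes B :: "'a::real_inner \<Rightarrow> 'a"
  assumes "\<And>x y. inner (B x) y = inner x (B y)"
  shows "inner (sqrt_iter B n x) y = inner x (sqrt_iter B n y)"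
  by (induction n arbitrary: x y) (simp_all add: assms inner_simps)

lemma norm_sqrt_iter_le:
  fixes B :: "'a::real_normed_vector \<Rightarrow> 'a"
  assumes "\<And>h. norm (B h) \<le> norm h"
  shows "norm (sqrt_iter B n h) \<le> sqrt_bound n * norm h"
proof (induction n arbitrary: h)
  case (Suc n)
  have "norm (sqrt_iter B n (sqrt_iter B n h)) \<le> sqrt_bound n * (sqrt_bound n * norm h)"
    using Suc[of "sqrt_iter B n h"] Suc[of h] sqrt_bound_range[of n]
    by (meson mult_left_mono order_trans)
  hence "norm (B h + sqrt_iter B n (sqrt_iter B n h)) \<le> (1 + (sqrt_bound n)\<^sup>2) * norm h"
    using assms[of h] norm_triangle_ineq[of "B h" "sqrt_iter B n (sqrt_iter B n h)"]
    by (simp add: power2_eq_square algebra_simps)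
  thus ?case by simp
qed simp

text \<open>Subtracting consecutive steps gives
  \<open>C\<^sub>n\<^sub>+\<^sub>1 - C\<^sub>n = (C\<^sub>n (C\<^sub>n - C\<^sub>n\<^sub>-\<^sub>1) + (C\<^sub>n - C\<^sub>n\<^sub>-\<^sub>1) C\<^sub>n\<^sub>-\<^sub>1) / 2\<close>, and the scalar
  iteration satisfies the same identity, so norm estimates pass from one step to the next.\<close>

lemma norm_sqrt_iter_step:
  fixes B :: "'a::real_normed_vector \<Rightarrow> 'a"
  assumes lin: "linear B" and con: "\<And>h. norm (B h) \<le> norm h"
  shows "norm (sqrt_iter B (Suc n) h - sqrt_iter B n h)
    \<le> (sqrt_bound (Suc n) - sqrt_bound n) * norm h"
proof (induction n arbitrary: h)
  case 0
  show ?case using con by simp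
next
  case (Suc n)
  let ?C = "sqrt_iter B (Suc n)" and ?D = "sqrt_iter B n"
  let ?c = "sqrt_bound (Suc n)" and ?d = "sqrt_bound n"
  have "sqrt_iter B (Suc (Suc n)) h - ?C h = (1/2) *\<^sub>R (?C (?C h) - ?D (?D h))"
    by (simp only: sqrt_iter.simps scaleR_diff_right[symmetric] add_diff_cancel_left)
  also have "?C (?C h) - ?D (?D h) = ?C (?C h - ?D h) + (?C (?D h) - ?D (?D h))"
    by (simp only: linear_diff[OF linear_sqrt_iter[OF lin]]) simp
  finally have eq: "sqrt_iter B (Suc (Suc n)) h - ?C h
    = (1/2) *\<^sub>R (?C (?C h - ?D h) + (?C (?D h) - ?D (?D h)))" .
  have 1: "norm (?C (?C h - ?D h)) \<le> ?c * ((?c - ?d) * norm h)"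
    using norm_sqrt_iter_le[OF con] Suc[of h] sqrt_bound_range[of "Suc n"]
    by (meson mult_left_mono order_trans)
  have 2: "norm (?C (?D h) - ?D (?D h)) \<le> (?c - ?d) * (?d * norm h)"
    using norm_sqrt_iter_le[OF con] Suc[of "?D h"] sqrt_bound_mono[of n]
    by (meson mult_left_mono order_trans diff_ge_0_iff_ge)
  have "norm (?C (?C h - ?D h) + (?C (?D h) - ?D (?D h)))
    \<le> ?c * ((?c - ?d) * norm h) + (?c - ?d) * (?d * norm h)"
    by (rule order_trans[OF norm_triangle_ineq add_mono[OF 1 2]])
  also have "\<dots> = (?c\<^sup>2 - ?d\<^sup>2) * norm h" by (simp only: power2_eq_square) algebra
  finally have "norm (sqrt_iter B (Suc (Suc n)) h - ?C h) \<le> (?c\<^sup>2 - ?d\<^sup>2) * norm h / 2"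
    unfolding eq by simp
  moreover have "sqrt_bound (Suc (Suc n)) - ?c = (?c\<^sup>2 - ?d\<^sup>2) / 2"
    by (simp only: sqrt_bound.simps(2)) (simp add: field_simps)
  ultimately show ?case by (simp only: times_divide_eq_left)
qed

lemma norm_sqrt_iter_diff_le:
  fixes B :: "'a::real_normed_vector \<Rightarrow> 'a"
  assumes "linear B" "\<And>h. norm (B h) \<le> norm h" and "n \<le> k"
  shows "norm (sqrt_iter B k h - sqrt_iter B n h) \<le> (sqrt_bound k - sqrt_bound n) * norm h"
  using \<open>n \<le> k\<close>
proof (induction k rule: dec_induct)
  case (step k)
  have "norm (sqrt_iter B (Suc k) h - sqrt_iter B n h)
    \<le> norm (sqrt_iter B (Suc k) h - sqrt_iter B k h) + norm (sqrt_iter B k h - sqrt_iter B n h)"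
    using norm_triangle_ineq[of "sqrt_iter B (Suc k) h - sqrt_iter B k h"
        "sqrt_iter B k h - sqrt_iter B n h"] by simp
  also have "\<dots> \<le> (sqrt_bound (Suc k) - sqrt_bound k) * norm h
      + (sqrt_bound k - sqrt_bound n) * norm h"
    by (rule add_mono[OF norm_sqrt_iter_step[OF assms(1,2)] step.IH])
  also have "\<dots> = (sqrt_bound (Suc k) - sqrt_bound n) * norm h" by algebra
  finally show ?case .
qed simp

lemma sqrt_iter_tendsto:
  fixes B :: "'a::complex_hilbert \<Rightarrow> 'a"
  assumes "linear B" "\<And>h. norm (B h) \<le> norm h"
  shows "(\<lambda>n. sqrt_iter B n h) \<longlonglongrightarrow> sqrt_limit B h"
proof -
  have "incseq sqrt_bound" using sqrt_bound_mono by (rule incseq_SucI)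
  hence "convergent sqrt_bound"
    using sqrt_bound_range by (metis incseq_convergent convergentI)
  hence C: "Cauchy sqrt_bound" by (rule convergent_Cauchy)
  have "Cauchy (\<lambda>n. sqrt_iter B n h)"
  proof (rule metric_CauchyI)
    fix e :: real assume e: "e > 0"
    obtain M where M: "\<And>k n. k \<ge> M \<Longrightarrow> n \<ge> M \<Longrightarrow>
        dist (sqrt_bound k) (sqrt_bound n) < e / (norm h + 1)"
      using metric_CauchyD[OF C, of "e / (norm h + 1)"] e
      by (metis add_nonneg_pos divide_pos_pos norm_ge_zero zero_less_one)
    have *: "norm (sqrt_iter B k h - sqrt_iter B n h) < e" if "n \<le> k" "n \<ge> M" for k n
    proof -
      have s: "sqrt_bound k - sqrt_bound n < e / (norm h + 1)"
        using M[of k n] that by (simp add: dist_real_def)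
      have "norm (sqrt_iter B k h - sqrt_iter B n h) \<le> (sqrt_bound k - sqrt_bound n) * norm h"
        by (rule norm_sqrt_iter_diff_le[OF assms that(1)])
      also have "\<dots> \<le> e / (norm h + 1) * norm h"
        using s by (intro mult_right_mono) auto
      also have "\<dots> < e"
        using e by (simp add: pos_divide_less_eq add_nonneg_pos distrib_left)
      finally show ?thesis .
    qed
    have "dist (sqrt_iter B k h) (sqrt_iter B n h) < e" if "k \<ge> M" "n \<ge> M" for k n
      using *[of n k] *[of k n] that by (cases "n \<le> k") (auto simp: dist_norm norm_minus_commute)
    thus "\<exists>M. \<forall>m\<ge>M. \<forall>n\<ge>M. dist (sqrt_iter B m h) (sqrt_iter B n h) < e" by blast
  qed
  thus ?thesis unfolding sqrt_limit_def using Cauchy_convergent convergent_LIMSEQ_iff by blast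
qed

text \<open>The case \<open>B = B'\<close> says that whatever commutes with \<open>B\<close> commutes with the limit; it serves
  for scalars and for the uniqueness of the root. The general case relates the two defect
  operators of a contraction.\<close>

lemma sqrt_limit_intertwine:
  fixes B :: "'a::complex_hilbert \<Rightarrow> 'a" and B' :: "'b::complex_hilbert \<Rightarrow> 'b"
  assumes "linear B" "\<And>h. norm (B h) \<le> norm h" "linear B'" "\<And>h. norm (B' h) \<le> norm h"
    and X: "bounded_linear X" "\<And>h. X (B h) = B' (X h)"
  shows "X (sqrt_limit B h) = sqrt_limit B' (X h)"
proof (rule LIMSEQ_unique)
  show "(\<lambda>n. X (sqrt_iter B n h)) \<longlonglongrightarrow> X (sqrt_limit B h)"
    by (intro bounded_linear.tendsto[OF X(1)] sqrt_iter_tendsto assms)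
  show "(\<lambda>n. X (sqrt_iter B n h)) \<longlonglongrightarrow> sqrt_limit B' (X h)"
    using sqrt_iter_intertwine[of X B B', OF bounded_linear.linear[OF X(1)] X(2)]
      sqrt_iter_tendsto[OF assms(3,4)] by simp
qed

lemma
  fixes B :: "'a::complex_hilbert \<Rightarrow> 'a"
  assumes B: "bounded_clinear B" and con: "\<And>h. norm (B h) \<le> norm h"
    and sym: "\<And>x y. inner (B x) y = inner x (B y)"
  shows positive_op_one_minus_sqrt_limit: "positive_op (\<lambda>h. h - sqrt_limit B h)"
    and one_minus_sqrt_limit_squared:
      "(h - sqrt_limit B h) - sqrt_limit B (h - sqrt_limit B h) = h - B h"
proof -
  let ?C = "sqrt_limit B"
  have lin: "linear B" using B by (simp add: bounded_clinear_def bounded_linear.linear)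
  note lim = sqrt_iter_tendsto[OF lin con]
  note itlin = linear_sqrt_iter[OF lin]
  have it_le: "norm (sqrt_iter B n h) \<le> norm h" for n h
    using norm_sqrt_iter_le[OF con, of n h] sqrt_bound_range[of n]
    by (meson mult_left_le_one_le norm_ge_zero order_trans)
  have C_le: "norm (?C h) \<le> norm h" for h
    by (rule LIMSEQ_le_const2[OF tendsto_norm[OF lim]]) (simp add: it_le)
  have add: "?C (x + y) = ?C x + ?C y" for x y
    using tendsto_add[OF lim[of x] lim[of y]] LIMSEQ_unique[OF lim[of "x + y"]]
    by (simp add: linear_add[OF itlin])
  have scl: "?C (c *\<^sub>C x) = c *\<^sub>C ?C x" for c x
    using bounded_clinear_scaleC[of c] B
    by (intro sqrt_limit_intertwine[OF lin con lin con, symmetric]) (auto simp: bounded_clinear_def)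
  have C: "bounded_clinear ?C" unfolding bounded_clinear_def
    using add scl C_le scl[of "complex_of_real _"]
    by (auto intro!: bounded_linear_intro[where K = 1] simp: scaleC_of_real)
  hence Clin: "linear ?C" by (simp add: bounded_clinear_def bounded_linear.linear)
  have Csym: "inner (?C x) y = inner x (?C y)" for x y
    by (rule LIMSEQ_unique[OF tendsto_inner[OF lim tendsto_const]])
      (simp add: sqrt_iter_symmetric[OF sym] tendsto_inner[OF tendsto_const lim])
  \<comment> \<open>Pointwise convergence together with the uniform bound \<open>it_le\<close> lets the limit pass
    through the composition \<open>C\<^sub>n C\<^sub>n\<close>.\<close>
  have fix_eq: "?C h = (1/2) *\<^sub>R (B h + ?C (?C h))" for h
  proof (rule LIMSEQ_unique)
    show "(\<lambda>n. sqrt_iter B (Suc n) h) \<longlonglongrightarrow> ?C h" using lim by (rule LIMSEQ_Suc)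
    have "(\<lambda>n. sqrt_iter B n (sqrt_iter B n h - ?C h)) \<longlonglongrightarrow> 0"
    proof (rule Lim_null_comparison[OF always_eventually])
      show "\<forall>n. norm (sqrt_iter B n (sqrt_iter B n h - ?C h)) \<le> norm (sqrt_iter B n h - ?C h)"
        using it_le by blast
      show "(\<lambda>n. norm (sqrt_iter B n h - ?C h)) \<longlonglongrightarrow> 0"
        using lim[of h] LIM_zero tendsto_norm_zero by blast
    qed
    from tendsto_add[OF this lim[of "?C h"]]
    have "(\<lambda>n. sqrt_iter B n (sqrt_iter B n h)) \<longlonglongrightarrow> ?C (?C h)"
      by (simp add: linear_diff[OF itlin])
    thus "(\<lambda>n. sqrt_iter B (Suc n) h) \<longlonglongrightarrow> (1/2) *\<^sub>R (B h + ?C (?C h))"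
      by (auto intro!: tendsto_intros)
  qed
  have "2 *\<^sub>R ?C h = B h + ?C (?C h)"
    by (subst fix_eq) simp
  thus "(h - ?C h) - ?C (h - ?C h) = h - B h"
    by (simp add: linear_diff[OF Clin] scaleR_2 algebra_simps)
  have "0 \<le> inner (x - ?C x) x" for x
  proof -
    have "inner (?C x) x \<le> norm (?C x) * norm x" by (rule norm_cauchy_schwarz)
    also have "\<dots> \<le> norm x * norm x" by (intro mult_right_mono C_le) auto
    finally show ?thesis by (simp add: inner_diff_left flip: power2_norm_eq_inner power2_eq_square)
  qed
  moreover have "bounded_clinear (\<lambda>x. x - ?C x)"
    using C by (auto simp: bounded_clinear_def scaleC_diff_right intro!: bounded_linear_sub)
  ultimately show "positive_op (\<lambda>h. h - ?C h)"
    by (simp add: positive_op_iff inner_simps Csym)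
qed

text \<open>A positive root \<open>S\<close> of \<open>1 - B\<close> commutes with its own square, hence with \<open>B\<close>, hence with
  the limit of the iteration. It therefore commutes with the constructed root and equals it.\<close>

lemma sqrt_op_one_minus:
  fixes B :: "'a::complex_hilbert \<Rightarrow> 'a"
  assumes B: "bounded_clinear B" and con: "\<And>h. norm (B h) \<le> norm h"
    and sym: "\<And>x y. inner (B x) y = inner x (B y)"
  shows "sqrt_op (\<lambda>h. h - B h) = (\<lambda>h. h - sqrt_limit B h)"
  unfolding sqrt_op_def
proof (rule the_equality)
  let ?R = "\<lambda>h. h - sqrt_limit B h"
  note pos = positive_op_one_minus_sqrt_limit[OF assms]
  note sq = one_minus_sqrt_limit_squared[OF assms]
  show "positive_op ?R \<and> ?R \<circ> ?R = (\<lambda>h. h - B h)"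
    using pos sq by (simp add: fun_eq_iff)
  fix S assume "positive_op S \<and> S \<circ> S = (\<lambda>h. h - B h)"
  hence S: "positive_op S" and SS: "\<And>h. S (S h) = h - B h" by (auto simp: fun_eq_iff)
  have bS: "bounded_linear S" using S by (simp add: positive_op_def bounded_clinear_def)
  have lin: "linear B" using B by (simp add: bounded_clinear_def bounded_linear.linear)
  have "S (B h) = B (S h)" for h
    using SS[of h] SS[of "S h"] linear_diff[OF bounded_linear.linear[OF bS], of h "B h"] by simp
  hence "S (sqrt_limit B h) = sqrt_limit B (S h)" for h
    using sqrt_limit_intertwine[OF lin con lin con bS] by blast
  hence "S (?R h) = ?R (S h)" for h
    by (simp add: linear_diff[OF bounded_linear.linear[OF bS]])
  thus "S = ?R"
    using S pos SS sq by (intro commuting_positive_roots_eq) auto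
qed

section \<open>Defect operators\<close>

text \<open>The relation \<open>defect_intertwine\<close> holds because \<open>T (T* T) = (T T*) T\<close> and
  intertwining carries over from \<open>B\<close> to the limit of the iteration.\<close>

lemma
  fixes T :: "'a::complex_hilbert \<Rightarrow> 'b::complex_hilbert"
  assumes T: "bounded_clinear T" and con: "\<And>x. norm (T x) \<le> norm x"
  shows positive_op_defect: "positive_op (sqrt_op (\<lambda>x. x - cadjoint T (T x)))"
    and defect_squared: "sqrt_op (\<lambda>x. x - cadjoint T (T x))
      (sqrt_op (\<lambda>x. x - cadjoint T (T x)) x) = x - cadjoint T (T x)"
    and positive_op_defect_adj: "positive_op (sqrt_op (\<lambda>y. y - T (cadjoint T y)))"
    and defect_intertwine: "T (sqrt_op (\<lambda>x. x - cadjoint T (T x)) x)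
      = sqrt_op (\<lambda>y. y - T (cadjoint T y)) (T x)"
proof -
  note adj = inner_cadjoint[OF T]
  note S = bounded_clinear_cadjoint_contraction[OF T con]
  have adj': "inner (cadjoint T y) x = inner y (T x)" for x y
    by (metis adj inner_commute)
  let ?B = "\<lambda>x. cadjoint T (T x)" and ?B' = "\<lambda>y. T (cadjoint T y)"
  have B: "bounded_clinear ?B" "\<And>x. norm (?B x) \<le> norm x" "\<And>x y. inner (?B x) y = inner x (?B y)"
    using S T con by (auto simp: bounded_clinear_def adj adj'
      intro: bounded_linear_compose order_trans)
  have B': "bounded_clinear ?B'" "\<And>x. norm (?B' x) \<le> norm x"
    "\<And>x y. inner (?B' x) y = inner x (?B' y)"
    using S T con by (auto simp: bounded_clinear_def adj adj'
      intro: bounded_linear_compose order_trans)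
  note eqs = sqrt_op_one_minus[OF B] sqrt_op_one_minus[OF B']
  show "positive_op (sqrt_op (\<lambda>x. x - ?B x))" "positive_op (sqrt_op (\<lambda>x. x - ?B' x))"
    unfolding eqs
    using positive_op_one_minus_sqrt_limit[OF B] positive_op_one_minus_sqrt_limit[OF B'] by auto
  show "sqrt_op (\<lambda>x. x - ?B x) (sqrt_op (\<lambda>x. x - ?B x) x) = x - ?B x"
    unfolding eqs by (rule one_minus_sqrt_limit_squared[OF B])
  have bT: "bounded_linear T" using T by (simp add: bounded_clinear_def)
  have lin: "linear ?B" "linear ?B'"
    using B(1) B'(1) by (auto simp: bounded_clinear_def bounded_linear.linear)
  show "T (sqrt_op (\<lambda>x. x - ?B x) x) = sqrt_op (\<lambda>x. x - ?B' x) (T x)"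
    unfolding eqs using sqrt_limit_intertwine[OF lin(1) B(2) lin(2) B'(2) bT]
    by (simp add: linear_diff[OF bounded_linear.linear[OF bT]])
qed

text \<open>The solution of \<open>h - Z h = y\<close> is the fixed point of the contraction \<open>h \<mapsto> y + Z h\<close>.\<close>

lemma bij_one_minus_strict_contraction:
  fixes Z :: "'a::{real_normed_vector,complete_space} \<Rightarrow> 'a"
  assumes "linear Z" "\<And>h. norm (Z h) \<le> r * norm h" "0 \<le> r" "r < 1"
  shows "bij (\<lambda>h. h - Z h)"
proof -
  have "\<exists>!h. y = h - Z h" for y
  proof -
    have "\<exists>!h. y + Z h = h"
      using assms(2)
      by (intro banach_fix_type[OF assms(3,4)]) (simp add: dist_norm flip: linear_diff[OF assms(1)])
    thus ?thesis by (metis add_diff_cancel_right' diff_add_cancel)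
  qed
  thus ?thesis by (simp add: bij_iff eq_commute)
qed

section \<open>The kernel of the characteristic function\<close>

lemma bounded_clinear_row_op:
  assumes "bounded_clinear A1" "bounded_clinear A2"
  shows "bounded_clinear (row_op A1 A2)"
proof -
  have "row_op A1 A2 = (\<lambda>x. A1 (fst x) + A2 (snd x))" by (auto simp: row_op_def)
  thus ?thesis using assms
    by (auto simp: bounded_clinear_def scaleC_prod_def scaleC_add_right
      intro!: bounded_linear_add bounded_linear_compose[OF _ bounded_linear_fst]
        bounded_linear_compose[OF _ bounded_linear_snd])
qed

lemma norm_row_op_le:
  assumes "commuting_2_contraction A1 A2"
  shows "norm (row_op A1 A2 Y) \<le> norm Y"
  using assms by (cases Y) (auto simp: commuting_2_contraction_def row_op_def norm_Pair
      intro!: real_le_rsqrt)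

lemma cadjoint_row_op:
  fixes A1 A2 :: "'a::complex_hilbert \<Rightarrow> 'a"
  assumes "bounded_clinear A1" "bounded_clinear A2"
  shows "cadjoint (row_op A1 A2) h = (cadjoint A1 h, cadjoint A2 h)"
  using assms
  by (intro cadjoint_eqI bounded_clinear_row_op)
    (auto simp: row_op_def inner_prod_def inner_add_left inner_cadjoint)

lemma norm_row_scaleC_le:
  fixes X :: "'a::complex_inner \<times> 'a"
  shows "norm (row_op (\<lambda>h. z1 *\<^sub>C h) (\<lambda>h. z2 *\<^sub>C h) X)
    \<le> sqrt ((cmod z1)\<^sup>2 + (cmod z2)\<^sup>2) * norm X"
proof -
  obtain x y where X: "X = (x, y)" by (cases X)
  have "norm (z1 *\<^sub>C x + z2 *\<^sub>C y) \<le> cmod z1 * norm x + cmod z2 * norm y"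
    using norm_triangle_ineq[of "z1 *\<^sub>C x" "z2 *\<^sub>C y"] by (simp add: norm_scaleC)
  also have "\<dots> = inner (cmod z1, cmod z2) (norm x, norm y)" by simp
  also have "\<dots> \<le> norm (cmod z1, cmod z2) * norm (norm x, norm y)"
    by (rule norm_cauchy_schwarz)
  finally show ?thesis by (simp add: X row_op_def norm_Pair)
qed

text \<open>With \<open>M = 1 - z A*\<close>, the value at \<open>D X\<close> is \<open>E (M\<inverse> z (1 - A* A) X - A X)\<close> by the intertwining
  relation. Injectivity of \<open>E\<close> removes the outer operator, and after applying \<open>M\<close> the terms
  \<open>z A* A X\<close> on both sides cancel.\<close>

lemma char_fun_defect_eq_0_iff:
  fixes A1 A2 :: "'a::complex_hilbert \<Rightarrow> 'a"
  assumes con: "commuting_2_contraction A1 A2"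
    and inj: "inj (defect_op_star A1 A2)"
    and ball: "(z1, z2) \<in> unit_ball2"
  shows "char_fun A1 A2 (z1, z2) (defect_op A1 A2 X) = 0 \<longleftrightarrow>
    row_op A1 A2 X = row_op (\<lambda>h. z1 *\<^sub>C h) (\<lambda>h. z2 *\<^sub>C h) X"
proof -
  let ?A = "row_op A1 A2" and ?z = "row_op (\<lambda>h. z1 *\<^sub>C h) (\<lambda>h. z2 *\<^sub>C h)"
  let ?D = "defect_op A1 A2" and ?E = "defect_op_star A1 A2"
  let ?M = "\<lambda>h. h - z1 *\<^sub>C cadjoint A1 h - z2 *\<^sub>C cadjoint A2 h"
  have A12: "bounded_clinear A1" "bounded_clinear A2"
    using con by (auto simp: commuting_2_contraction_def)
  have A: "bounded_clinear ?A" by (rule bounded_clinear_row_op[OF A12])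
  note le = norm_row_op_le[OF con]
  note adj = bounded_clinear_cadjoint_contraction[OF A le]
  have z: "bounded_clinear ?z" by (intro bounded_clinear_row_op bounded_clinear_scaleC)
  have lin: "linear ?z" "linear (\<lambda>h. ?z (cadjoint ?A h))"
    using z adj(1) by (auto simp: bounded_clinear_def
        intro: bounded_linear.linear bounded_linear_compose)
  have M_eq: "?M h = h - ?z (cadjoint ?A h)" for h
    unfolding cadjoint_row_op[OF A12] by (simp add: row_op_def)
  define r where "r = sqrt ((cmod z1)\<^sup>2 + (cmod z2)\<^sup>2)"
  have r: "0 \<le> r" "r < 1" using ball by (auto simp: r_def unit_ball2_def)
  have "norm (?z (cadjoint ?A h)) \<le> r * norm h" for h
    using norm_row_scaleC_le[of z1 z2 "cadjoint ?A h"] adj(2)[of h] r(1)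
    unfolding r_def by (meson mult_left_mono order_trans)
  hence bij: "bij ?M" unfolding M_eq by (rule bij_one_minus_strict_contraction[OF lin(2) _ r])
  have E: "linear ?E"
    using positive_op_defect_adj[OF A le]
    by (simp add: defect_op_star_def positive_op_def bounded_clinear_def bounded_linear.linear)
  have inv_iff: "inv f a = b \<longleftrightarrow> a = f b" if "bij f" for f :: "'a \<Rightarrow> 'a" and a b
    using that by (metis bij_inv_eq_iff)
  have E_eq_0: "?E w = 0 \<longleftrightarrow> w = 0" for w
    using inj linear_0[OF E] by (metis injD)
  have "?D X \<in> defect_space A1 A2"
    unfolding defect_space_def by (rule subsetD[OF closure_subset rangeI])
  hence "char_fun A1 A2 (z1, z2) (?D X) = - ?A (?D X) + ?E (inv ?M (?z (?D (?D X))))"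
    by (simp add: char_fun_def)
  also have "?A (?D X) = ?E (?A X)"
    unfolding defect_op_def defect_op_star_def by (rule defect_intertwine[OF A le])
  also have "?D (?D X) = X - cadjoint ?A (?A X)"
    unfolding defect_op_def by (rule defect_squared[OF A le])
  finally have "char_fun A1 A2 (z1, z2) (?D X)
      = ?E (inv ?M (?z (X - cadjoint ?A (?A X))) - ?A X)"
    by (simp add: linear_diff[OF E])
  hence "char_fun A1 A2 (z1, z2) (?D X) = 0 \<longleftrightarrow>
      inv ?M (?z (X - cadjoint ?A (?A X))) = ?A X"
    by (simp add: E_eq_0)
  also have "\<dots> \<longleftrightarrow> ?z (X - cadjoint ?A (?A X)) = ?M (?A X)"
    by (rule inv_iff[OF bij])
  also have "\<dots> \<longleftrightarrow> ?A X = ?z X"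
    unfolding M_eq linear_diff[OF lin(1)] by auto
  finally show ?thesis .
qed

text \<open>Here \<open>X = A* A X\<close>, so \<open>A\<close> does not shrink the norm of \<open>X\<close>, whereas \<open>z\<close> does unless
  \<open>X = 0\<close>.\<close>

lemma defect_eigenvector_eq_0:
  fixes A1 A2 :: "'a::complex_hilbert \<Rightarrow> 'a"
  assumes con: "commuting_2_contraction A1 A2"
    and ball: "(z1, z2) \<in> unit_ball2"
    and D0: "defect_op A1 A2 X = 0"
    and eig: "row_op A1 A2 X = row_op (\<lambda>h. z1 *\<^sub>C h) (\<lambda>h. z2 *\<^sub>C h) X"
  shows "X = 0"
proof (rule ccontr)
  assume "X \<noteq> 0"
  let ?A = "row_op A1 A2"
  have A: "bounded_clinear ?A"
    using con by (intro bounded_clinear_row_op) (auto simp: commuting_2_contraction_def)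
  note le = norm_row_op_le[OF con]
  have D: "linear (defect_op A1 A2)"
    using positive_op_defect[OF A le]
    by (simp add: defect_op_def positive_op_def bounded_clinear_def bounded_linear.linear)
  have "X - cadjoint ?A (?A X) = defect_op A1 A2 (defect_op A1 A2 X)"
    unfolding defect_op_def by (rule defect_squared[OF A le, symmetric])
  hence "X = cadjoint ?A (?A X)" by (simp add: D0 linear_0[OF D])
  hence "norm X \<le> norm (?A X)"
    using bounded_clinear_cadjoint_contraction(2)[OF A le] by metis
  also have "\<dots> \<le> sqrt ((cmod z1)\<^sup>2 + (cmod z2)\<^sup>2) * norm X"
    unfolding eig by (rule norm_row_scaleC_le)
  also have "\<dots> < norm X" using ball \<open>X \<noteq> 0\<close> by (simp add: unit_ball2_def)
  finally show False by simp
qed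

theorem proposition2:
  fixes A1 A2 :: "'a::complex_hilbert \<Rightarrow> 'a" and z1 z2 :: complex
  assumes "commuting_2_contraction A1 A2"
    and "pure_pair A1 A2"
    and "inj (defect_op_star A1 A2)"
    and "(z1, z2) \<in> unit_ball2"
  shows "(z1, z2) \<in> taylor_spectrum2 A1 A2 \<longleftrightarrow>
    (\<exists>Y. char_fun A1 A2 (z1, z2) Y = 0 \<and> Y \<noteq> 0 \<and>
      (\<exists>X. Y = defect_op A1 A2 X \<and>
        (\<forall>h. X \<noteq> (A1 h - z1 *\<^sub>C h, z2 *\<^sub>C h - A2 h))))"
    (is "?L \<longleftrightarrow> ?R")
proof -
  let ?eig = "\<lambda>X. row_op A1 A2 X = row_op (\<lambda>h. z1 *\<^sub>C h) (\<lambda>h. z2 *\<^sub>C h) X"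
  let ?new = "\<lambda>X. \<forall>h. X \<noteq> (A1 h - z1 *\<^sub>C h, z2 *\<^sub>C h - A2 h)"
  have lin: "linear A1" "linear A2"
    using assms(1) by (auto simp: commuting_2_contraction_def bounded_clinear_def
      bounded_linear.linear)
  have spec: "?L \<longleftrightarrow> (\<exists>X. ?eig X \<and> ?new X)"
  proof -
    \<comment> \<open>The sign change of the second component matches both the equations and the excluded
      vectors.\<close>
    have sign: "(A1 x1 - z1 *\<^sub>C x1) - (A2 x2 - z2 *\<^sub>C x2) = 0 \<longleftrightarrow> ?eig (x1, - x2)" for x1 x2
      by (simp add: row_op_def linear_neg[OF lin(2)] linear_neg[OF linear_scaleC] algebra_simps)
    have sign': "(\<forall>h. (x1, x2) \<noteq> (A1 h - z1 *\<^sub>C h, A2 h - z2 *\<^sub>C h)) \<longleftrightarrow> ?new (x1, - x2)" for x1 x2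
      by (simp add: neg_eq_iff_add_eq_0 eq_diff_eq algebra_simps) (metis add.commute)
    have "?L \<longleftrightarrow> (\<exists>x1 x2. ?eig (x1, - x2) \<and> ?new (x1, - x2))"
      by (simp only: taylor_spectrum2_def mem_Collect_eq case_prod_conv sign sign')
    also have "\<dots> \<longleftrightarrow> (\<exists>X. ?eig X \<and> ?new X)"
      by (metis add.inverse_inverse surj_pair)
    finally show ?thesis .
  qed
  \<comment> \<open>The vector \<open>X = 0\<close> is excluded by the choice \<open>h = 0\<close>.\<close>
  have nz: "defect_op A1 A2 X \<noteq> 0" if "?eig X" "?new X" for X
  proof
    assume "defect_op A1 A2 X = 0"
    hence "X = 0" using defect_eigenvector_eq_0[OF assms(1,4)] that(1) by blast
    moreover have "(A1 0 - z1 *\<^sub>C 0, z2 *\<^sub>C 0 - A2 0) = 0"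
      by (simp add: linear_0[OF lin(1)] linear_0[OF lin(2)] linear_0[OF linear_scaleC] zero_prod_def)
    ultimately show False using that(2) by metis
  qed
  show ?thesis
    unfolding spec using nz char_fun_defect_eq_0_iff[OF assms(1,3,4)] by blast
qed

end
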